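(* Let $k \geq 6$ and $r \geq 3$ be integers. Every minimal graph $G$ with average degree at least $\tfrac{4}{3}kr$ contains a set of $k$ pairwise vertex-disjoint cycles, each with at least $r$ vertices.
   Context: Graphs are finite and simple. The average degree of a graph $G$ is $d(G) = 2|E(G)|/|V(G)|$. A graph $G$ is called minimal if every vertex deletion and every edge contraction (removing any resulting parallel edges) produces a graph with strictly smaller average degree than $d(G)$. *)

theory Defs
  imports Complex_Main
begin

record 'a ugraph =
  verts :: "'a set"
  edges :: "'a set set"

definition simple_graph :: "'a ugraph \<Rightarrow> bool" where
  "simple_graph G \<longleftrightarrow> finite (verts G) \<and> (\<forall>e\<in>edges G. e \<subseteq> verts G \<and> card e = 2)"

text \<open>The null graph gets average degree \<open>0\<close>, since division by zero is zero.\<close>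

definition avg_degree :: "'a ugraph \<Rightarrow> real" where
  "avg_degree G = 2 * real (card (edges G)) / real (card (verts G))"

definition delete_vertex :: "'a ugraph \<Rightarrow> 'a \<Rightarrow> 'a ugraph" where
  "delete_vertex G v = \<lparr>verts = verts G - {v}, edges = {e \<in> edges G. v \<notin> e}\<rparr>"

text \<open>Contraction of the edge \<open>{u, v}\<close>, with \<open>u\<close> serving as the merged vertex: \<open>v\<close> is renamed
  to \<open>u\<close> in every edge. The contracted edge becomes the loop \<open>{u}\<close>, which is dropped; parallel
  edges coincide because the edges form a set. Exchanging \<open>u\<close> and \<open>v\<close> gives an isomorphic graph.\<close>

definition contract_edge :: "'a ugraph \<Rightarrow> 'a \<Rightarrow> 'a \<Rightarrow> 'a ugraph" where
  "contract_edge G u v =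
     \<lparr>verts = verts G - {v}, edges = (\<lambda>e. (id(v := u)) ` e) ` edges G - {{u}}\<rparr>"

definition minimal_graph :: "'a ugraph \<Rightarrow> bool" where
  "minimal_graph G \<longleftrightarrow>
     (\<forall>v\<in>verts G. avg_degree (delete_vertex G v) < avg_degree G) \<and>
     (\<forall>u v. {u, v} \<in> edges G \<longrightarrow> avg_degree (contract_edge G u v) < avg_degree G)"

text \<open>A cycle is given by its cyclic vertex sequence, without repeating the first vertex at the
  end, so its number of vertices is the length of the list. That the vertices belong to the graph
  follows from \<open>simple_graph G\<close>.\<close>

definition is_cycle :: "'a ugraph \<Rightarrow> 'a list \<Rightarrow> bool" where
  "is_cycle G c \<longleftrightarrow> length c \<ge> 3 \<and> distinct c \<and>
     (\<forall>i<length c. {c ! i, c ! (Suc i mod length c)} \<in> edges G)"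

end

theory Submission
  imports Defs
begin

text \<open>Minimality forces every degree to be at least \<open>(2kr + 1) / 3\<close> and every edge to lie in at
  least \<open>(2kr - 2) / 3\<close> triangles. Build cycles with exactly \<open>r\<close> vertices one vertex at a time:
  next to a packing \<open>T\<close> of \<open>r\<close>-cycles keep a shorter closed path \<open>D\<close> in the rest \<open>F\<close>, and suppose
  no exchange lengthens \<open>D\<close>. A vertex \<open>x\<close> of a cycle \<open>C\<close> in \<open>T\<close> that is adjacent to both ends of \<open>D\<close>
  would lengthen \<open>D\<close>, so \<open>C\<close> must not be repairable without \<open>x\<close>. Repairing with a single vertex
  outside \<open>D\<close> shows by counting that vertices of \<open>F\<close> outside \<open>D\<close> have degree and codegree more than
  \<open>r / 2\<close> inside \<open>F\<close>; hence they have at most one neighbour on \<open>D\<close>, as otherwise \<open>D\<close> could be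
  lengthened inside \<open>F\<close>. A maximal fan outside \<open>D\<close> then consists of more than \<open>r / 2\<close> vertices and
  offers repair paths of every length up to its size between two adjacent vertices with few common
  neighbours in \<open>F\<close>. So these two have many common neighbours on \<open>T\<close>, and a weighted count
  produces a repairable cycle.\<close>

section \<open>Closed paths in a finite graph\<close>

locale fin_graph =
  fixes V :: "'a set" and adj :: "'a \<Rightarrow> 'a \<Rightarrow> bool"
  assumes finite_V: "finite V"
    and adj_in_V: "adj u v \<Longrightarrow> u \<in> V"
    and adj_sym: "adj u v \<Longrightarrow> adj v u"
    and adj_irrefl: "\<not> adj u u"
begin

definition nbs :: "'a \<Rightarrow> 'a set" where
  "nbs v = {u. adj v u}"

lemma in_nbs [simp]: "u \<in> nbs v \<longleftrightarrow> adj v u"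
  by (simp add: nbs_def)

lemma nbs_subset: "nbs v \<subseteq> V"
  using adj_in_V adj_sym by (auto simp: nbs_def)

lemma finite_nbs [simp]: "finite (nbs v)"
  using nbs_subset finite_V finite_subset by blast

text \<open>The empty path, single vertices and single edges count as closed, so that a closed path
  can be grown vertex by vertex into a cycle.\<close>

definition closed_path :: "'a list \<Rightarrow> bool" where
  "closed_path c \<longleftrightarrow> distinct c \<and> set c \<subseteq> V \<and> successively adj c \<and>
     (length c \<ge> 2 \<longrightarrow> adj (last c) (hd c))"

lemma closed_path_rotate_append: "closed_path (xs @ ys) \<Longrightarrow> closed_path (ys @ xs)"
  by (cases "xs = []"; cases "ys = []")
    (auto simp: closed_path_def successively_append_iff Suc_le_eq length_greater_0_conv[symmetric]
      simp del: length_greater_0_conv)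

lemma closed_path_rotate: "closed_path c \<Longrightarrow> closed_path (rotate n c)"
  using closed_path_rotate_append[of "take (n mod length c) c" "drop (n mod length c) c"]
  by (simp add: rotate_drop_take)

lemma closed_path_startE:
  assumes "closed_path c" "x \<in> set c"
  obtains xs where "closed_path (x # xs)" "set (x # xs) = set c" "length (x # xs) = length c"
proof -
  obtain ys zs where c: "c = ys @ x # zs"
    using assms(2) by (auto dest: split_list)
  show thesis
    using that[of "zs @ ys"] closed_path_rotate_append[of ys "x # zs"] assms(1) c by auto
qed

lemma closed_path_snoc:
  assumes "closed_path c" "c \<noteq> []" "x \<notin> set c" "adj (last c) x" "adj x (hd c)"
  shows "closed_path (c @ [x])"
  using assms adj_in_V by (auto simp: closed_path_def successively_append_iff)

end

lemma mod_add_cancel_nat: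
  fixes x y :: nat
  assumes "(a + x) mod n = (a + y) mod n"
  shows "x mod n = y mod n"
  using assms by (simp add: nat_mod_eq_iff)

text \<open>Since a shift does not change the count, conditions on a cycle at different offsets can
  be compared position by position.\<close>

lemma card_indices_rotate:
  assumes "distinct c"
  shows "card {i. i < length c \<and> c ! ((s + i) mod length c) \<in> B} = card (B \<inter> set c)"
proof -
  have "{i. i < length c \<and> c ! ((s + i) mod length c) \<in> B}
      = {i. i < length (rotate s c) \<and> rotate s c ! i \<in> B}"
    by (auto simp: nth_rotate)
  also have "card \<dots> = length (filter (\<lambda>x. x \<in> B) (rotate s c))"
    by (simp add: length_filter_conv_card)
  also have "\<dots> = card (set (filter (\<lambda>x. x \<in> B) (rotate s c)))"
    using assms by (simp only: distinct_card[OF distinct_filter] distinct_rotate)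
  also have "set (filter (\<lambda>x. x \<in> B) (rotate s c)) = B \<inter> set c"
    by auto
  finally show ?thesis .
qed

section \<open>Cycle packings that cannot be improved\<close>

definition (in fin_graph) cycle_packing :: "nat \<Rightarrow> 'a list set \<Rightarrow> bool" where
  "cycle_packing r T \<longleftrightarrow> finite T \<and> (\<forall>c\<in>T. closed_path c \<and> length c = r) \<and>
     pairwise (\<lambda>c d. disjnt (set c) (set d)) T"

text \<open>A packing of \<open>r\<close>-cycles together with a shorter closed path \<open>D\<close>, such that
  no packing of the same size leaves room for a closed path with one more vertex.\<close>

locale stuck_packing = fin_graph +
  fixes k r :: nat and T :: "'a list set" and D :: "'a list"
  assumes k: "k \<ge> 3" and r: "r \<ge> 3"
    and degree: "v \<in> V \<Longrightarrow> 2 * k * r + 1 \<le> 3 * card (nbs v)"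
    and codegree: "adj u v \<Longrightarrow> 2 * k * r \<le> 3 * card (nbs u \<inter> nbs v) + 2"
    and card_V: "k * r \<le> card V"
    and packing: "cycle_packing r T"
    and card_T: "card T < k"
    and closed_D: "closed_path D"
    and length_D: "length D < r"
    and disjoint_D: "c \<in> T \<Longrightarrow> set c \<inter> set D = {}"
    and stuck: "\<lbrakk>cycle_packing r T'; card T' = card T; closed_path D';
      \<And>c. c \<in> T' \<Longrightarrow> set c \<inter> set D' = {}\<rbrakk> \<Longrightarrow> length D' \<noteq> length D + 1"
begin

definition U where "U = (\<Union>c\<in>T. set c)"
definition F where "F = V - U"
definition S where "S = F - set D"
text \<open>Appending a vertex of \<open>A\<close> that is not on \<open>D\<close> lengthens
  \<open>D\<close>. If \<open>D\<close> is a single vertex \<open>v\<close>, then \<open>A\<close>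
  is \<open>nbs v\<close>.\<close>

definition A where "A = {x. adj (last D) x \<and> adj x (hd D)}"

lemma T_D:
  assumes "c \<in> T"
  shows "closed_path c" "length c = r" "set c \<subseteq> V" "distinct c" "set c \<subseteq> U" "card (set c) = r"
  using assms packing by (auto simp: cycle_packing_def closed_path_def U_def distinct_card)

lemma finite_T: "finite T"
  using packing by (simp add: cycle_packing_def)

lemma U_sub: "U \<subseteq> V" using T_D by (auto simp: U_def)
lemma F_sub: "F \<subseteq> V" by (auto simp: F_def)
lemma finite_UF [simp]: "finite U" "finite F" "finite S"
  using finite_V U_sub F_sub by (auto simp: S_def intro: finite_subset)
lemma S_sub_F: "S \<subseteq> F" by (auto simp: S_def)
lemma D_sub_F: "set D \<subseteq> F"
  using closed_D disjoint_D by (auto simp: F_def U_def closed_path_def)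

lemma card_Int_U: "card (B \<inter> U) = (\<Sum>c\<in>T. card (B \<inter> set c))"
proof -
  have "card (\<Union>c\<in>T. B \<inter> set c) = (\<Sum>c\<in>T. card (B \<inter> set c))"
    using packing by (intro card_UN_disjoint)
      (fastforce simp: cycle_packing_def pairwise_def disjnt_def)+
  moreover have "(\<Union>c\<in>T. B \<inter> set c) = B \<inter> U"
    by (auto simp: U_def)
  ultimately show ?thesis by simp
qed

lemma card_split:
  assumes "B \<subseteq> V" shows "card B = card (B \<inter> U) + card (B \<inter> F)"
proof -
  have "card ((B \<inter> U) \<union> (B \<inter> F)) = card (B \<inter> U) + card (B \<inter> F)"
    by (intro card_Un_disjoint finite_Int disjI2 finite_UF) (auto simp: F_def)
  moreover have "(B \<inter> U) \<union> (B \<inter> F) = B"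
    using assms by (auto simp: F_def)
  ultimately show ?thesis by simp
qed

lemma no_closed_path_in_F:
  assumes "closed_path c" "set c \<subseteq> F" "length c = length D + 1"
  shows False
  using stuck[OF packing refl assms(1)] assms(2,3) by (auto simp: F_def U_def)

lemma card_U: "card U = r * card T"
  using card_Int_U[of UNIV] by (simp add: T_D)

lemma card_F: "r \<le> card F"
proof -
  have "card U + r \<le> k * r"
    using mult_le_mono1[of "Suc (card T)" k r] card_T by (simp add: card_U algebra_simps)
  then show ?thesis
    using card_V card_split[of V] U_sub F_sub by (simp add: Int_absorb1)
qed

lemma D_nonempty: "D \<noteq> []"
proof
  assume D: "D = []"
  have "F \<noteq> {}" using card_F r by auto
  then obtain v where "v \<in> F" by blast
  then show False
    using no_closed_path_in_F[of "[v]"] D F_sub by (auto simp: closed_path_def)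
qed

lemma S_nonempty: "S \<noteq> {}"
proof
  assume "S = {}"
  then have "card F \<le> card (set D)"
    by (intro card_mono) (auto simp: S_def)
  then show False
    using card_F length_D card_length[of D] by linarith
qed

lemma A_F: "A \<inter> F \<subseteq> set D - {hd D, last D}"
proof
  fix x assume x: "x \<in> A \<inter> F"
  have "x \<in> set D"
  proof (rule ccontr)
    assume "x \<notin> set D"
    then show False
      using no_closed_path_in_F[of "D @ [x]"] closed_path_snoc[OF closed_D D_nonempty] x D_sub_F
      by (auto simp: A_def)
  qed
  then show "x \<in> set D - {hd D, last D}"
    using x adj_irrefl by (auto simp: A_def)
qed

lemma A_eq: "A = nbs (last D) \<inter> nbs (hd D)"
  using adj_sym by (auto simp: A_def)

text \<open>If \<open>D\<close> has at least two vertices, its closing edge has large codegree, and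
  by \<open>A_F\<close> at most \<open>length D - 2\<close> elements of \<open>A\<close> lie in
  \<open>F\<close>. If \<open>D\<close> is one vertex, its degree is used instead and
  \<open>A\<close> misses \<open>F\<close>.\<close>

lemma card_A: "2 * k * r + 7 \<le> 3 * card (A \<inter> U) + 3 * r"
proof (cases "length D \<ge> 2")
  case True
  have d: "distinct D" and adj: "adj (last D) (hd D)"
    using closed_D True by (auto simp: closed_path_def)
  have "hd D \<noteq> last D" using adj adj_irrefl by auto
  then have "card {hd D, last D} = 2" by simp
  moreover have "card (set D - {hd D, last D}) = card (set D) - card {hd D, last D}"
    using D_nonempty by (intro card_Diff_subset) auto
  ultimately have "card (A \<inter> F) + 2 \<le> length D"
    using card_mono[OF _ A_F] distinct_card[OF d] True by simp
  moreover have "2 * k * r \<le> 3 * card A + 2"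
    using codegree[OF adj] A_eq by simp
  moreover have "card A = card (A \<inter> U) + card (A \<inter> F)"
    using card_split A_eq nbs_subset by auto
  ultimately show ?thesis using length_D by linarith
next
  case False
  then obtain v where D: "D = [v]"
    using D_nonempty by (cases D; cases "tl D") auto
  have "v \<in> V" using D D_sub_F F_sub by auto
  moreover have "A = nbs v" using A_eq D by simp
  moreover have "card (A \<inter> U) = card A"
    using card_split[of A] A_F D \<open>A = nbs v\<close> nbs_subset by (auto simp: card_0_eq)
  ultimately show ?thesis using degree[of v] r by simp
qed

text \<open>Reroute the cycle through \<open>R\<close> so as to release \<open>x\<close>, which then enlarges \<open>D\<close>.\<close>

lemma no_reroute:
  assumes c: "c \<in> T" and x: "x \<in> A" "set c = set (x # xs @ mid @ ys)"
    and closed: "closed_path (x # xs @ mid @ ys)"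
    and R: "closed_path (mid @ R)" "set R \<subseteq> S" "length R = Suc (length xs + length ys)"
  shows False
proof -
  let ?c = "mid @ R"
  let ?T = "insert ?c (T - {c})"
  have dist: "distinct (x # xs @ mid @ ys)"
    using closed by (simp add: closed_path_def)
  have len: "length ?c = r"
  proof -
    have "length (x # xs @ mid @ ys) = r"
      using distinct_card[OF dist] T_D(6)[OF c] unfolding x(2) by (rule trans[OF sym])
    then show ?thesis using R(3) by simp
  qed
  have xD: "x \<notin> set D" and xU: "x \<in> U"
    using x c disjoint_D by (auto simp: U_def)
  have S_disj: "set R \<inter> U = {}" "set R \<inter> set D = {}"
    using R(2) by (auto simp: S_def F_def)
  have other: "set d \<inter> set c = {}" if "d \<in> T - {c}" for d
    using packing c that by (auto simp: cycle_packing_def pairwise_def disjnt_def)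
  have disj: "set d \<inter> set ?c = {}" if "d \<in> T - {c}" for d
  proof -
    have "set mid \<subseteq> set c" using x(2) by auto
    moreover have "set d \<subseteq> U" using that T_D(5) by blast
    ultimately show ?thesis using other[OF that] S_disj(1) by auto
  qed
  \<comment> \<open>A new cycle already present would be disjoint from itself, hence empty. So the
    exchange keeps the number of cycles.\<close>
  have notin: "?c \<notin> T - {c}"
  proof
    assume "?c \<in> T - {c}"
    then have "set ?c \<inter> set ?c = {}" by (rule disj)
    then have "R = []" by simp
    then show False using R(3) by simp
  qed
  have "cycle_packing r ?T"
    unfolding cycle_packing_def
  proof (intro conjI)
    show "finite ?T" using finite_T by simp
    show "\<forall>d\<in>?T. closed_path d \<and> length d = r"
      using T_D len R(1) by auto
    show "pairwise (\<lambda>c d. disjnt (set c) (set d)) ?T"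
      unfolding pairwise_insert
    proof (intro conjI allI impI)
      fix d assume "d \<in> T - {c} \<and> d \<noteq> ?c"
      then have "set d \<inter> set ?c = {}" using disj by blast
      then show "disjnt (set ?c) (set d)" "disjnt (set d) (set ?c)"
        unfolding disjnt_def by blast+
    next
      show "pairwise (\<lambda>c d. disjnt (set c) (set d)) (T - {c})"
        using packing pairwise_subset unfolding cycle_packing_def by blast
    qed
  qed
  moreover have "card ?T = card T"
    using card.remove[OF finite_T c] notin finite_T by simp
  moreover have "closed_path (D @ [x])"
    using closed_path_snoc[OF closed_D D_nonempty xD] x(1) by (simp add: A_def)
  moreover have "set d \<inter> set (D @ [x]) = {}" if "d \<in> ?T" for d
  proof (cases "d = ?c")
    case True
    have "set mid \<subseteq> set c" "x \<notin> set mid" using x(2) dist by auto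
    moreover have "x \<notin> set R" using S_disj(1) xU by auto
    ultimately show ?thesis
      unfolding True using disjoint_D[OF c] S_disj(2) by auto
  next
    case False
    then have "d \<in> T - {c}" using that by auto
    moreover have "x \<in> set c" using x(2) by simp
    ultimately have "x \<notin> set d" using other by blast
    then show ?thesis using disjoint_D[of d] \<open>d \<in> T - {c}\<close> by auto
  qed
  ultimately show False
    using stuck[of ?T "D @ [x]"] by simp
qed

section \<open>Exchanging a single vertex, and degrees inside \<open>F\<close>\<close>

text \<open>Otherwise three sets of positions modulo \<open>r\<close> have total size above
  \<open>2 * r\<close>, hence a common element: a vertex of \<open>A\<close> whose predecessor and
  successor on \<open>c\<close> are both adjacent to \<open>w\<close>. Then \<open>w\<close> can
  replace it.\<close>

lemma card_cycle_weighted: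
  assumes w: "w \<in> S" and c: "c \<in> T"
  shows "card (A \<inter> set c) + 2 * card (nbs w \<inter> set c) \<le> 2 * r"
proof (rule ccontr)
  assume large: "\<not> ?thesis"
  have c': "distinct c" "length c = r" "closed_path c" using T_D[OF c] by auto
  let ?X = "{i. i < r \<and> c ! ((1 + i) mod r) \<in> A}"
  let ?Y = "{i. i < r \<and> c ! ((0 + i) mod r) \<in> nbs w}"
  let ?Z = "{i. i < r \<and> c ! ((2 + i) mod r) \<in> nbs w}"
  have cards: "card ?X = card (A \<inter> set c)" "card ?Y = card (nbs w \<inter> set c)"
    "card ?Z = card (nbs w \<inter> set c)"
    using card_indices_rotate[OF c'(1), of _ A] card_indices_rotate[OF c'(1), of _ "nbs w"] c'(2)
    by metis+
  have fin: "finite ?X" "finite ?Y" "finite ?Z" by auto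
  have "card (?X \<union> ?Y) + card (?X \<inter> ?Y) = card ?X + card ?Y"
    using card_Un_Int[OF fin(1,2)] by simp
  moreover have "card ((?X \<inter> ?Y) \<union> ?Z) + card ((?X \<inter> ?Y) \<inter> ?Z) = card (?X \<inter> ?Y) + card ?Z"
    using card_Un_Int[of "?X \<inter> ?Y" ?Z] by simp
  moreover have "card (?X \<union> ?Y) \<le> card {..<r}" "card ((?X \<inter> ?Y) \<union> ?Z) \<le> card {..<r}"
    by (rule card_mono; auto)+
  ultimately have "card ((?X \<inter> ?Y) \<inter> ?Z) \<noteq> 0"
    using large cards unfolding card_lessThan by linarith
  then have "(?X \<inter> ?Y) \<inter> ?Z \<noteq> {}" by (metis card.empty)
  then obtain i where i: "i < r" "c ! ((1 + i) mod r) \<in> A" "c ! ((0 + i) mod r) \<in> nbs w"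
    "c ! ((2 + i) mod r) \<in> nbs w"
    by blast
  have rot: "rotate i c ! n = c ! ((n + i) mod r)" if "n < r" for n
    using that c' by (simp add: nth_rotate add.commute)
  obtain y x z zs where c'': "rotate i c = y # x # z # zs"
  proof -
    have "3 \<le> length (rotate i c)" using c' r by simp
    then show thesis using that
      by (cases "rotate i c"; cases "tl (rotate i c)"; cases "tl (tl (rotate i c))") auto
  qed
  have "x \<in> A" "adj w y" "adj w z"
    using i r rot[of 0] rot[of 1] rot[of 2] by (auto simp: c'')
  have "closed_path (y # x # z # zs)"
    using closed_path_rotate[OF c'(3), of i] c'' by simp
  then have closed: "closed_path (x # [] @ (z # zs @ [y]) @ [])"
    using closed_path_rotate_append[of "[y]" "x # z # zs"] by simp
  have set_c: "set c = set (x # [] @ (z # zs @ [y]) @ [])"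
    using set_rotate[of i c] unfolding c'' by auto
  have "w \<notin> set c" "w \<in> V"
    using w T_D[OF c] S_sub_F F_sub by (auto simp: S_def F_def)
  then have "closed_path ((z # zs @ [y]) @ [w])"
    unfolding closed_path_def
  proof (intro conjI impI)
    show "distinct ((z # zs @ [y]) @ [w])"
      using closed \<open>w \<notin> set c\<close> set_c by (auto simp: closed_path_def)
    show "set ((z # zs @ [y]) @ [w]) \<subseteq> V"
      using closed \<open>w \<in> V\<close> by (simp add: closed_path_def)
    have "successively adj (z # zs @ [y])"
      using closed by (simp add: closed_path_def successively_Cons)
    then show "successively adj ((z # zs @ [y]) @ [w])"
      unfolding successively_append_iff[of _ "z # zs @ [y]"]
      using adj_sym[OF \<open>adj w y\<close>] by simp
    show "adj (last ((z # zs @ [y]) @ [w])) (hd ((z # zs @ [y]) @ [w]))"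
      using \<open>adj w z\<close> by simp
  qed
  then show False
    by (rule no_reroute[OF c \<open>x \<in> A\<close> set_c closed]) (use w in auto)
qed

text \<open>Summing over at most k - 1 cycles and inserting \<open>card_A\<close> leaves at most
  2kr/3 - r/2 - 7/6 neighbours of \<open>w\<close> on \<open>U\<close>. Degrees and codegrees are
  about 2kr/3 or larger, so more than r/2 of each remains for \<open>F\<close>.\<close>

lemma card_nbs_U:
  assumes "w \<in> S"
  shows "2 * k * r + 6 * card (nbs w \<inter> U) + 7 + 6 * r \<le> 6 * k * r + 3 * r"
proof -
  have "card (A \<inter> U) + 2 * card (nbs w \<inter> U) = (\<Sum>c\<in>T. card (A \<inter> set c) + 2 * card (nbs w \<inter> set c))"
    by (simp add: card_Int_U sum.distrib sum_distrib_left)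
  also have "\<dots> \<le> (\<Sum>c\<in>T. 2 * r)"
    using card_cycle_weighted[OF assms] by (rule sum_mono)
  also have "\<dots> = 2 * (r * card T)" by simp
  finally have "card (A \<inter> U) + 2 * card (nbs w \<inter> U) \<le> 2 * (r * card T)" .
  moreover have "r * card T + r \<le> k * r"
    using mult_le_mono1[of "Suc (card T)" k r] card_T by (simp add: algebra_simps)
  ultimately show ?thesis using card_A by linarith
qed

lemma degree_F:
  assumes "w \<in> S"
  shows "r + 3 \<le> 2 * card (nbs w \<inter> F)"
  using card_nbs_U[OF assms] degree[of w] card_split[OF nbs_subset, of w] assms S_sub_F F_sub
  by fastforce

text \<open>Common neighbours on \<open>U\<close> are in particular neighbours of \<open>w\<close>,
  so \<open>v\<close> is unrestricted and may lie on \<open>D\<close>.\<close>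

lemma codegree_F:
  assumes "w \<in> S" "adj w v"
  shows "r + 1 \<le> 2 * card (nbs w \<inter> nbs v \<inter> F)"
proof -
  have "card (nbs w \<inter> nbs v \<inter> U) \<le> card (nbs w \<inter> U)"
    by (intro card_mono) auto
  moreover have "card (nbs w \<inter> nbs v) = card (nbs w \<inter> nbs v \<inter> U) + card (nbs w \<inter> nbs v \<inter> F)"
    using nbs_subset by (intro card_split) auto
  ultimately show ?thesis
    using card_nbs_U[OF assms(1)] codegree[OF assms(2)] by linarith
qed


section \<open>Neighbours on \<open>D\<close>\<close>

text \<open>Distance is measured along \<open>D\<close> in one direction. For
  \<open>s = length D\<close> the two vertices coincide, so a single neighbour on \<open>D\<close>
  already gives \<open>at_dist (length D)\<close>.\<close>

definition at_dist :: "nat \<Rightarrow> bool" where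
  "at_dist s \<longleftrightarrow> (\<exists>g\<in>S. \<exists>p<length D. adj g (D ! p) \<and> adj g (D ! ((p + s) mod length D)))"

text \<open>A fan at \<open>D ! p\<close> with \<open>s\<close> vertices could replace the \<open>s - 1\<close> vertices of \<open>D\<close>
  strictly between \<open>D ! p\<close> and \<open>D ! (p + s)\<close>.\<close>

lemma no_fan_at_D:
  assumes p: "p < length D" and s: "0 < s" "s < length D"
    and g: "adj (last ws) (D ! ((p + s) mod length D))"
    and ws: "distinct ws" "set ws \<subseteq> S \<inter> nbs (D ! p)"
      "successively adj ws" "length ws = s"
  shows False
proof -
  define E where "E = rotate p D"
  have E: "closed_path E" "length E = length D" "set E = set D"
    using closed_path_rotate[OF closed_D] by (auto simp: E_def)
  have E_nth: "E ! i = D ! ((p + i) mod length D)" if "i < length D" for i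
    using that by (simp add: E_def nth_rotate)
  obtain x as where xas: "E = x # as"
    using E(2) s by (cases E) auto
  then have x: "x = D ! p" using E_nth[of 0] p D_nonempty by simp
  have "s - 1 < length as" using xas E(2) s by auto
  then have "as = take (s - 1) as @ as ! (s - 1) # drop (Suc (s - 1)) as"
    "length (take (s - 1) as) = s - 1"
    using id_take_nth_drop[of "s - 1" as] by auto
  then obtain l y ys where as: "as = l @ y # ys" "length l = s - 1"
    by metis
  have y: "y = D ! ((p + s) mod length D)"
  proof -
    have "E ! s = (x # l @ y # ys) ! Suc (length l)" using xas as s(1) by simp
    also have "\<dots> = y" by simp
    finally show ?thesis using E_nth[of s] s(2) by simp
  qed
  \<comment> \<open>From \<open>y\<close> onwards along \<open>D\<close> to \<open>x\<close>, then
    back through the fan: the \<open>s - 1\<close> vertices of \<open>l\<close> are traded for the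
    \<open>s\<close> vertices of \<open>ws\<close>.\<close>
  let ?N = "(y # ys) @ x # ws"
  have rot: "closed_path ((y # ys) @ x # l)"
    using closed_path_rotate_append[of "x # l" "y # ys"] E(1) xas as by simp
  have ws_disj: "set ws \<inter> set D = {}" "set ws \<subseteq> V"
    using ws(2) S_sub_F F_sub by (auto simp: S_def)
  have set_D: "set (x # l @ y # ys) = set D" using E xas as by simp
  have "ws \<noteq> []" using ws(4) s by auto
  then have "hd ws \<in> nbs x" using subsetD[OF ws(2) hd_in_set] x by blast
  have "closed_path ?N"
    unfolding closed_path_def
  proof (intro conjI impI)
    show "distinct ?N" using rot ws(1) ws_disj set_D by (auto simp: closed_path_def)
    show "set ?N \<subseteq> V" using rot ws_disj by (auto simp: closed_path_def)
    have "successively adj (y # ys)" "adj (last (y # ys)) x"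
      using rot unfolding closed_path_def successively_append_iff by simp_all
    then show "successively adj ?N"
      unfolding successively_append_iff
      using ws(3) \<open>hd ws \<in> nbs x\<close> by (simp add: successively_Cons)
    show "adj (last ?N) (hd ?N)" using g y \<open>ws \<noteq> []\<close> by simp
  qed
  moreover have "set ?N \<subseteq> F"
    using ws(2) S_sub_F D_sub_F set_D by auto
  moreover have "length ?N = length D + 1"
    using E(2) xas as ws(4) s by simp
  ultimately show False by (rule no_closed_path_in_F)
qed

text \<open>The cyclic intervals of \<open>s\<close> positions starting at the neighbours of
  \<open>g\<close> are pairwise disjoint, since an overlap would put two neighbours at a positive
  distance below \<open>s\<close>.\<close>

lemma card_nbs_D:
  assumes g: "g \<in> S" and s: "s \<le> length D" "\<And>d. \<lbrakk>0 < d; d < s\<rbrakk> \<Longrightarrow> \<not> at_dist d"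
  shows "card (nbs g \<inter> set D) * s \<le> length D"
proof -
  let ?l = "length D"
  let ?I = "{i. i < ?l \<and> D ! ((0 + i) mod ?l) \<in> nbs g}"
  have l: "?l > 0" using D_nonempty by simp
  have shift: "i = j" if "i < ?l" "j < ?l" "adj g (D ! i)" "adj g (D ! j)" "a \<le> b" "b < s"
    "(i + a) mod ?l = (j + b) mod ?l" for i j a b
  proof -
    have "i mod ?l = (j + (b - a)) mod ?l"
    proof (rule mod_add_cancel_nat)
      have "a + (j + (b - a)) = j + b" using that(5) by simp
      then show "(a + i) mod ?l = (a + (j + (b - a))) mod ?l"
        using that(7) by (simp only: add.commute[of a i])
    qed
    then have i: "i = (j + (b - a)) mod ?l" using that(1) by simp
    then have "at_dist (b - a)"
      unfolding at_dist_def using g that(2-4) by metis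
    then have "b - a = 0"
      using s(2)[of "b - a"] that(6) by linarith
    then show ?thesis using i that(2) by simp
  qed
  have "inj_on (\<lambda>(i, a). (i + a) mod ?l) (?I \<times> {..<s})"
  proof (rule inj_onI)
    fix u v
    assume uv: "u \<in> ?I \<times> {..<s}" "v \<in> ?I \<times> {..<s}"
      "(case u of (i, a) \<Rightarrow> (i + a) mod ?l) = (case v of (j, b) \<Rightarrow> (j + b) mod ?l)"
    obtain i a j b where eq: "u = (i, a)" "v = (j, b)" by fastforce
    then have *: "i < ?l" "adj g (D ! i)" "a < s" "j < ?l" "adj g (D ! j)" "b < s"
      "(i + a) mod ?l = (j + b) mod ?l"
      using uv by auto
    have "i = j"
    proof (cases "a \<le> b")
      case True
      then show ?thesis using shift[of i j a b] * by simp
    next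
      case False
      then show ?thesis using shift[of j i b a] * by simp
    qed
    moreover have "a = b"
      using mod_add_cancel_nat[of i a ?l b] * \<open>i = j\<close> s(1) by simp
    ultimately show "u = v" by (simp add: eq)
  qed
  then have "card (?I \<times> {..<s}) \<le> card {..<?l}"
    using l by (intro card_inj_on_le[of "\<lambda>(i, a). (i + a) mod ?l"]) auto
  then show ?thesis
    using card_indices_rotate[of D 0 "nbs g"] closed_D
    by (simp add: card_cartesian_product closed_path_def)
qed

text \<open>If \<open>g\<close> had two neighbours on \<open>D\<close>, then two of them at minimal distance \<open>s\<close> (over all
  choices of \<open>g\<close>) would leave every vertex of \<open>S\<close> at most \<open>length D / s\<close> neighbours on \<open>D\<close>; the
  codegrees inside \<open>F\<close> are too large for a fan of fewer than \<open>s\<close> vertices to be maximal.\<close>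

lemma card_nbs_D_le_1:
  assumes g: "g \<in> S"
  shows "card (nbs g \<inter> set D) \<le> 1"
proof (rule ccontr)
  assume two: "\<not> ?thesis"
  let ?l = "length D"
  have ex: "\<exists>s>0. s \<le> ?l \<and> at_dist s"
  proof -
    have "\<not> nbs g \<inter> set D \<subseteq> {}" using two by auto
    then obtain p where p: "p < ?l" "adj g (D ! p)"
      by (auto simp: in_set_conv_nth)
    then have "D ! ((p + ?l) mod ?l) = D ! p" by simp
    then have "at_dist ?l" unfolding at_dist_def using g p by metis
    then show ?thesis using D_nonempty by blast
  qed
  define s where "s = (LEAST s. 0 < s \<and> at_dist s)"
  have s: "0 < s" "at_dist s"
    using LeastI_ex[of "\<lambda>s. 0 < s \<and> at_dist s"] ex by (auto simp: s_def)
  have least: "\<not> at_dist d" if "0 < d" "d < s" for d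
    using that not_less_Least[of d "\<lambda>s. 0 < s \<and> at_dist s"] by (auto simp: s_def)
  have sl: "s \<le> ?l"
    using least ex by (meson not_le order_less_le_trans)
  have card_D: "card (nbs w \<inter> set D) * s \<le> ?l" if "w \<in> S" for w
    using card_nbs_D[OF that sl] least by blast
  have half: "2 * s \<le> ?l"
    using card_D[OF g] two mult_le_mono1[of 2 "card (nbs g \<inter> set D)" s] by linarith
  obtain h p where hp: "h \<in> S" "p < ?l" "adj h (D ! p)" "adj h (D ! ((p + s) mod ?l))"
    using s(2) by (auto simp: at_dist_def)
  let ?x = "D ! p"
  \<comment> \<open>The fan grows by prepending to \<open>h\<close>, so its last vertex stays
    adjacent to \<open>D ! ((p + s) mod ?l)\<close>.\<close>
  have fan: "\<exists>ws. length ws = m \<and> distinct ws \<and> set ws \<subseteq> S \<inter> nbs ?x \<and> successively adj ws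
      \<and> ws \<noteq> [] \<and> last ws = h" if "1 \<le> m" "m \<le> s" for m
    using that
  proof (induction m rule: dec_induct)
    case base
    show ?case
      by (rule exI[of _ "[h]"]) (use hp adj_sym in auto)
  next
    case (step m)
    then obtain ws where ws: "length ws = m" "distinct ws" "set ws \<subseteq> S \<inter> nbs ?x"
      "successively adj ws" "ws \<noteq> []" "last ws = h" by auto
    let ?w = "hd ws"
    have w: "?w \<in> S" "adj ?w ?x" "?w \<in> set ws"
      using hd_in_set[OF ws(5)] subsetD[OF ws(3)] adj_sym by auto
    \<comment> \<open>Otherwise all common neighbours of \<open>?w\<close> and \<open>?x\<close> in
      \<open>F\<close> lie on \<open>D\<close> or in the fan, too few for
      \<open>codegree_F\<close>.\<close>
    have "\<not> nbs ?w \<inter> nbs ?x \<inter> F \<subseteq> (nbs ?w \<inter> set D - {?x}) \<union> (set ws - {?w})"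
    proof
      assume "nbs ?w \<inter> nbs ?x \<inter> F \<subseteq> (nbs ?w \<inter> set D - {?x}) \<union> (set ws - {?w})"
      then have "card (nbs ?w \<inter> nbs ?x \<inter> F) \<le> card ((nbs ?w \<inter> set D - {?x}) \<union> (set ws - {?w}))"
        by (rule card_mono[rotated]) auto
      also have "\<dots> \<le> card (nbs ?w \<inter> set D - {?x}) + card (set ws - {?w})"
        by (rule card_Un_le)
      also have "card (nbs ?w \<inter> set D - {?x}) = card (nbs ?w \<inter> set D) - 1"
        using w hp(2) by (intro card_Diff_singleton) auto
      also have "card (set ws - {?w}) = m - 1"
        using w(3) ws by (simp add: distinct_card)
      finally have le: "r + 1 \<le> 2 * (card (nbs ?w \<inter> set D) - 1 + (m - 1))"
        using codegree_F[OF w(1,2)] by (meson mult_le_mono2 order_trans)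
      let ?a = "card (nbs ?w \<inter> set D)"
      have as: "?a * s \<le> ?l" by (rule card_D[OF w(1)])
      have ms: "m < s" "1 \<le> m" using step by auto
      show False
      proof (cases "?a \<ge> 2")
        case True
        \<comment> \<open>As \<open>?a\<close> and \<open>s\<close> are at least 2,
          (\<open>?a\<close> - 2)(\<open>s\<close> - 2) \<ge> 0 gives 2(\<open>?a\<close> +
          \<open>s\<close> - 2) \<le> \<open>?a * s\<close> \<le> \<open>?l\<close> <
          \<open>r\<close>, against \<open>le\<close> and \<open>m < s\<close>.\<close>
        then obtain a' s' where "?a = a' + 2" "s = s' + 2"
          using ms by (metis add.commute le_Suc_ex Suc_1 Suc_leI le_less_trans)
        then show False using le as ms length_D by (auto simp: algebra_simps)
      next
        case False
        then have "?a - 1 = 0" by simp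
        then have "r + 1 \<le> 2 * (m - 1)" using le by simp
        then show False using half ms length_D by linarith
      qed
    qed
    then obtain u where u': "u \<in> nbs ?w \<inter> nbs ?x \<inter> F"
      "u \<notin> (nbs ?w \<inter> set D - {?x}) \<union> (set ws - {?w})"
      by blast
    then have "u \<noteq> ?w" "u \<noteq> ?x" using adj_irrefl by auto
    then have u: "adj ?w u" "adj ?x u" "u \<in> F" "u \<notin> set D" "u \<notin> set ws"
      using u' by auto
    show ?case
      by (rule exI[of _ "u # ws"])
        (use u ws adj_sym in \<open>auto simp: S_def successively_Cons\<close>)
  qed
  from fan[of s] s(1) obtain ws where "length ws = s" "distinct ws" "set ws \<subseteq> S \<inter> nbs ?x"
    "successively adj ws" "last ws = h" by auto
  moreover have "s < ?l" using half s(1) by linarith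
  ultimately show False
    using no_fan_at_D[of p s ws] hp s(1) by auto
qed

section \<open>Maximal fans and the weighted count\<close>

text \<open>In a longest path inside \<open>S \<inter> nbs w\<close>, a missed common neighbour of
  \<open>w\<close> and \<open>hd us\<close> could be prepended. Such paths exist by
  \<open>degree_F\<close>, as at most one neighbour of \<open>w\<close> is on
  \<open>D\<close>.\<close>

lemma maximal_fan:
  assumes w: "w \<in> S"
  obtains us where "distinct us" "set us \<subseteq> S \<inter> nbs w" "successively adj us" "us \<noteq> []"
    "nbs w \<inter> nbs (hd us) \<inter> S \<subseteq> set us"
proof -
  let ?P = "\<lambda>us. distinct us \<and> set us \<subseteq> S \<inter> nbs w \<and> successively adj us"
  have "card (nbs w \<inter> F) \<le> card (nbs w \<inter> S) + card (nbs w \<inter> set D)"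
    by (rule order_trans[OF card_mono card_Un_le]) (auto simp: S_def)
  moreover have "card (nbs w \<inter> set D) \<le> 1" "r + 3 \<le> 2 * card (nbs w \<inter> F)"
    using card_nbs_D_le_1 degree_F w by auto
  ultimately have "card (nbs w \<inter> S) \<noteq> 0" using r by linarith
  then have "nbs w \<inter> S \<noteq> {}" by (metis card.empty)
  then obtain v where "v \<in> nbs w \<inter> S" by blast
  then have v: "?P [v]" by simp
  have "length us < Suc (card S)" if "?P us" for us
    using that card_mono[of S "set us"] by (auto simp: distinct_card)
  then obtain us where us: "?P us" "\<And>vs. ?P vs \<Longrightarrow> length vs \<le> length us"
    using ex_has_greatest_nat[of ?P "[v]" length "Suc (card S)"] v by blast
  have ne: "us \<noteq> []" using us(2)[OF v] by auto
  have "nbs w \<inter> nbs (hd us) \<inter> S \<subseteq> set us"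
  proof
    fix x assume x: "x \<in> nbs w \<inter> nbs (hd us) \<inter> S"
    show "x \<in> set us"
    proof (rule ccontr)
      assume "x \<notin> set us"
      then have "?P (x # us)" using us(1) x adj_sym by (simp add: successively_Cons)
      then show False using us(2)[of "x # us"] by simp
    qed
  qed
  then show thesis using that us(1) ne by blast
qed

text \<open>As \<open>w\<close> is adjacent to the whole fan, it can end any initial segment. This
  yields paths to \<open>w\<close> with any number of vertices from 1 to
  \<open>length us + 1\<close>.\<close>

lemma fan_path:
  assumes w: "w \<in> S" and us: "distinct us" "set us \<subseteq> S \<inter> nbs w" "successively adj us"
  shows "distinct (take n us @ [w])" "set (take n us @ [w]) \<subseteq> S"
    "successively adj (take n us @ [w])"
proof -
  have t: "set (take n us) \<subseteq> set us" by (rule set_take_subset)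
  have "w \<notin> set us" using us(2) adj_irrefl by auto
  then show "distinct (take n us @ [w])" using us(1) t by auto
  show "set (take n us @ [w]) \<subseteq> S" using us(2) t w by auto
  have "successively adj (take n us)"
    using us(3) append_take_drop_id[of n us] by (metis successively_append_iff)
  moreover have "adj (last (take n us)) w" if "take n us \<noteq> []"
    using last_in_set[OF that] t us(2) adj_sym by auto
  ultimately show "successively adj (take n us @ [w])"
    by (auto simp: successively_append_iff)
qed

text \<open>Either no vertex of \<open>c\<close> can be released to enlarge \<open>D\<close>, or the common neighbours of \<open>w\<close>
  and \<open>hd us\<close> on \<open>c\<close> are so clustered that the fan cannot bridge the gap around a released vertex.\<close>

lemma card_cycle_fan:
  assumes w: "w \<in> S" and us: "distinct us" "set us \<subseteq> S \<inter> nbs w" "successively adj us"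
    and c: "c \<in> T" and x: "x \<in> A \<inter> set c" and len: "length us + 2 \<le> r"
  shows "card (nbs w \<inter> nbs (hd us) \<inter> set c) + (length us + 1) \<le> r"
proof -
  define Z where "Z = nbs w \<inter> nbs (hd us)"
  obtain as where as: "closed_path (x # as)" "set (x # as) = set c" "length (x # as) = length c"
    using closed_path_startE[OF T_D(1)[OF c], of x] x by blast
  have "card (Z \<inter> set c) + (length us + 1) \<le> r"
  proof (cases "Z \<inter> set as = {}")
    case True
    then have "Z \<inter> set c \<subseteq> {x}" using as(2) by auto
    then have "card (Z \<inter> set c) \<le> card {x}" by (intro card_mono) auto
    then show ?thesis using len by simp
  next
    case False
    \<comment> \<open>\<open>y\<close> and \<open>z\<close>, possibly equal, are the first and last
      elements of \<open>Z\<close> on the way round from \<open>x\<close>. The gap to be bridged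
      consists of \<open>ys\<close>, \<open>x\<close> and \<open>xs\<close>.\<close>
    then obtain xs y zs where y: "as = xs @ y # zs" "y \<in> Z" "\<forall>v\<in>set xs. v \<notin> Z"
      using split_list_first_prop[of as "\<lambda>v. v \<in> Z"] by blast
    then obtain ls z ys where z: "y # zs = ls @ z # ys" "z \<in> Z" "\<forall>v\<in>set ys. v \<notin> Z"
      using split_list_last_prop[of "y # zs" "\<lambda>v. v \<in> Z"] by auto
    define mid where "mid = ls @ [z]"
    have mid: "as = xs @ mid @ ys" "hd mid = y" "last mid = z" "mid \<noteq> []"
      using y(1) z(1) by (auto simp: mid_def hd_append split: list.splits if_splits)
        (metis list.sel(1) append_Cons hd_append2 list.distinct(1))+
    have closed: "closed_path (x # xs @ mid @ ys)" using as(1) mid(1) by simp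
    have set_c: "set c = set (x # xs @ mid @ ys)" using as(2) mid(1) by simp
    show ?thesis
    proof (cases "length xs + length ys \<le> length us")
      case True
      define R where "R = take (length xs + length ys) us @ [w]"
      have R: "distinct R" "set R \<subseteq> S" "successively adj R"
        using fan_path[OF w us] by (auto simp: R_def)
      have R_U: "set R \<inter> set mid = {}"
        using R(2) set_c T_D(5)[OF c] by (auto simp: S_def F_def)
      \<comment> \<open>The bridge starts at \<open>w\<close> if \<open>x\<close> alone is replaced
        and at \<open>hd us\<close> otherwise; \<open>z\<close>, being in \<open>Z\<close>, is
        adjacent to both.\<close>
      have hd_R: "hd R = w \<or> hd R = hd us" by (cases us) (auto simp: R_def hd_append)
      have "closed_path (mid @ R)"
        unfolding closed_path_def
      proof (intro conjI impI)
        show "distinct (mid @ R)"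
          using R(1) closed R_U by (auto simp: closed_path_def)
        show "set (mid @ R) \<subseteq> V"
          using closed R(2) S_sub_F F_sub by (auto simp: closed_path_def)
        have "successively adj mid"
          using closed by (auto simp: closed_path_def successively_append_iff successively_Cons)
        moreover have "adj (last mid) (hd R)"
          using hd_R mid(3) z(2) adj_sym by (auto simp: Z_def)
        ultimately show "successively adj (mid @ R)"
          using R(3) by (simp add: successively_append_iff)
        show "adj (last (mid @ R)) (hd (mid @ R))"
          using mid y(2) by (simp add: R_def Z_def)
      qed
      moreover have "length R = Suc (length xs + length ys)" using True by (simp add: R_def)
      ultimately show ?thesis
        using no_reroute[OF c _ set_c closed _ R(2)] x by auto
    next
      case False
      \<comment> \<open>Now \<open>xs\<close> and \<open>ys\<close> together have at least
        \<open>length us + 1\<close> vertices, none of them in \<open>Z\<close>.\<close>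
      have "Z \<inter> set c \<subseteq> insert x (set mid)" using set_c y(3) z(3) by auto
      then have "card (Z \<inter> set c) \<le> card (insert x (set mid))" by (intro card_mono) auto
      also have "\<dots> \<le> Suc (length mid)"
        using card_length[of "x # mid"] by simp
      finally show ?thesis
        using False as(3) mid(1) T_D(2)[OF c] by simp
    qed
  qed
  then show ?thesis by (simp add: Z_def)
qed

lemma not_stuck: False
proof -
  obtain w where w: "w \<in> S" using S_nonempty by blast
  obtain us where us: "distinct us" "set us \<subseteq> S \<inter> nbs w" "successively adj us" "us \<noteq> []"
    and maximal: "nbs w \<inter> nbs (hd us) \<inter> S \<subseteq> set us"
    using maximal_fan[OF w] by blast
  let ?m = "length us" and ?u = "hd us"
  define Z where "Z = nbs w \<inter> nbs ?u"
  have u: "?u \<in> set us" "adj w ?u" using hd_in_set[OF us(4)] us(2) by auto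
  \<comment> \<open>\<open>?u\<close> is not its own neighbour, which makes up for the one neighbour
    that \<open>w\<close> may have on \<open>D\<close>.\<close>
  have "Z \<inter> F \<subseteq> (set us - {?u}) \<union> (nbs w \<inter> set D)"
    using maximal adj_irrefl by (auto simp: Z_def S_def)
  then have "card (Z \<inter> F) \<le> card ((set us - {?u}) \<union> (nbs w \<inter> set D))"
    by (intro card_mono) auto
  also have "\<dots> \<le> card (set us - {?u}) + card (nbs w \<inter> set D)" by (rule card_Un_le)
  also have "card (set us - {?u}) = ?m - 1" using u us(1) by (simp add: distinct_card)
  also have "?m - 1 + card (nbs w \<inter> set D) \<le> ?m"
    using card_nbs_D_le_1[OF w] us(4) by (cases us) auto
  finally have Z_F: "card (Z \<inter> F) \<le> ?m" .
  have m_lower: "r + 1 \<le> 2 * ?m"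
    using codegree_F[OF w u(2)] Z_F by (simp add: Z_def)
  have Z_U: "2 * k * r \<le> 3 * card (Z \<inter> U) + 3 * ?m + 2"
  proof -
    have "card Z = card (Z \<inter> U) + card (Z \<inter> F)"
      using nbs_subset by (intro card_split) (auto simp: Z_def)
    then show ?thesis using codegree[OF u(2)] Z_F by (simp add: Z_def)
  qed
  \<comment> \<open>Otherwise \<open>length D\<close> fan vertices together with \<open>w\<close>
    form a closed path in \<open>F\<close> that is one vertex longer than \<open>D\<close>.\<close>
  have "?m < length D"
  proof (rule ccontr)
    assume long: "\<not> ?m < length D"
    let ?R = "take (length D) us @ [w]"
    have R: "distinct ?R" "set ?R \<subseteq> S" "successively adj ?R"
      using fan_path[OF w us(1-3)] by auto
    moreover have "hd ?R = ?u" using D_nonempty us(4) by (cases us; cases D) auto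
    ultimately have "closed_path ?R"
      using u(2) S_sub_F F_sub unfolding closed_path_def by auto
    then show False
      using no_closed_path_in_F[of ?R] R(2) S_sub_F long by auto
  qed
  then have m_upper: "?m + 2 \<le> r" using length_D by linarith
  \<comment> \<open>The weights balance two extremes: if \<open>A\<close> misses \<open>c\<close>,
    then \<open>Z\<close> may fill it; otherwise \<open>A\<close> may fill \<open>c\<close>, but
    \<open>Z\<close> misses at least \<open>?m + 1\<close> of its vertices.\<close>
  have "(?m + 1) * card (A \<inter> set c) + r * card (Z \<inter> set c) \<le> r * r" if c: "c \<in> T" for c
  proof (cases "A \<inter> set c = {}")
    case True
    have "card (Z \<inter> set c) \<le> card (set c)" by (intro card_mono) auto
    then show ?thesis using True T_D(6)[OF c] by simp
  next
    case False
    then obtain x where "x \<in> A \<inter> set c" by blast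
    then have "card (Z \<inter> set c) + (?m + 1) \<le> r"
      using card_cycle_fan[OF w us(1-3) c _ m_upper] by (simp add: Z_def)
    moreover have "card (A \<inter> set c) \<le> card (set c)" by (intro card_mono) auto
    then have "card (A \<inter> set c) \<le> r" using T_D(6)[OF c] by simp
    then have "(?m + 1) * card (A \<inter> set c) \<le> (?m + 1) * r" by (rule mult_le_mono2)
    moreover have "r * (card (Z \<inter> set c) + (?m + 1)) \<le> r * r"
      using calculation(1) by (rule mult_le_mono2)
    ultimately show ?thesis by (simp add: algebra_simps)
  qed
  then have "(\<Sum>c\<in>T. (?m + 1) * card (A \<inter> set c) + r * card (Z \<inter> set c)) \<le> (\<Sum>c\<in>T. r * r)"
    by (rule sum_mono)
  then have "(?m + 1) * card (A \<inter> U) + r * card (Z \<inter> U) \<le> card T * (r * r)"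
    by (simp add: card_Int_U sum.distrib sum_distrib_left)
  moreover have "card T * (r * r) + r * r \<le> k * (r * r)"
    using mult_le_mono1[of "Suc (card T)" k "r * r"] card_T by simp
  ultimately have weighted: "(?m + 1) * card (A \<inter> U) + r * card (Z \<inter> U) + r * r \<le> k * (r * r)"
    by linarith
  \<comment> \<open>With k = j + 3 the comparison of the bounds reduces to (m + 1)(2jr + 7) + r
    \<le> jr^2, where m is \<open>?m\<close>. By \<open>m_lower\<close>, 2(m + 1) \<ge> r + 3, so
    the left side is already larger than jr^2.\<close>
  obtain j where j: "k = j + 3" using k by (metis add.commute le_Suc_ex)
  have "(?m + 1) * (2 * k * r + 7) + r * (2 * k * r)
      \<le> (?m + 1) * (3 * card (A \<inter> U) + 3 * r) + r * (3 * card (Z \<inter> U) + 3 * ?m + 2)"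
    by (intro add_mono mult_le_mono2 card_A Z_U)
  also have "\<dots> + 3 * (r * r) \<le> 3 * (k * (r * r)) + (?m + 1) * (3 * r) + r * (3 * ?m + 2)"
    using weighted by (simp add: algebra_simps)
  finally have "(?m + 1) * (2 * j * r + 7) + r \<le> j * (r * r)"
    unfolding j by (simp add: algebra_simps)
  moreover have "(r + 3) * (2 * j * r + 7) \<le> 2 * (?m + 1) * (2 * j * r + 7)"
    using m_lower by (intro mult_le_mono1) simp
  ultimately show False
    using r by (simp add: algebra_simps)
qed

end

section \<open>Growing a packing vertex by vertex\<close>

context fin_graph
begin

text \<open>The quantity \<open>card T * r + length D\<close> is raised one unit at a time up to
  \<open>k * r\<close>; a pair \<open>T\<close>, \<open>D\<close> where this fails would be a
  \<open>stuck_packing\<close>.\<close>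

theorem ex_cycle_packing:
  assumes "k \<ge> 3" "r \<ge> 3"
    and "\<And>v. v \<in> V \<Longrightarrow> 2 * k * r + 1 \<le> 3 * card (nbs v)"
    and "\<And>u v. adj u v \<Longrightarrow> 2 * k * r \<le> 3 * card (nbs u \<inter> nbs v) + 2"
    and "k * r \<le> card V"
  shows "\<exists>T. cycle_packing r T \<and> card T = k"
proof -
  define P where "P n \<longleftrightarrow> (\<exists>T D. cycle_packing r T \<and> closed_path D \<and> length D < r \<and>
    (\<forall>c\<in>T. set c \<inter> set D = {}) \<and> card T * r + length D = n)" for n
  have "P n" if "n \<le> k * r" for n
    using that
  proof (induction n)
    case 0
    show ?case unfolding P_def
      by (rule exI[of _ "{}"], rule exI[of _ "[]"])
        (use assms(2) in \<open>auto simp: cycle_packing_def closed_path_def\<close>)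
  next
    case (Suc n)
    then obtain T D where TD: "cycle_packing r T" "closed_path D" "length D < r"
      "\<And>c. c \<in> T \<Longrightarrow> set c \<inter> set D = {}" "card T * r + length D = n"
      unfolding P_def by auto
    have "card T * r < k * r" using TD(5) Suc.prems by linarith
    then have "card T < k" by simp
    show ?case
    proof (rule ccontr)
      assume not_P: "\<not> P (Suc n)"
      have "stuck_packing V adj k r T D"
      proof
        fix T' D'
        assume T': "cycle_packing r T'" "card T' = card T" "closed_path D'"
          and disj: "\<And>c. c \<in> T' \<Longrightarrow> set c \<inter> set D' = {}"
        show "length D' \<noteq> length D + 1"
        proof
          assume len: "length D' = length D + 1"
          show False
          proof (cases "length D' < r")
            case True
            then have "P (Suc n)"
              unfolding P_def using T' disj TD(5) len by (intro exI[of _ T'] exI[of _ D']) auto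
            then show False using not_P by blast
          next
            \<comment> \<open>A path that has reached \<open>r\<close> vertices joins the packing,
              and growth restarts from the empty path.\<close>
            case False
            then have len_r: "length D' = r" using len TD(3) by simp
            have "D' \<notin> T'" using disj[of D'] len by auto
            have "cycle_packing r (insert D' T')"
              using T' disj len_r unfolding cycle_packing_def pairwise_insert disjnt_def
              by (auto simp: Int_commute)
            moreover have "card (insert D' T') * r + length [] = Suc n"
              using \<open>D' \<notin> T'\<close> T'(1,2) len len_r TD(5) by (simp add: cycle_packing_def)
            ultimately have "P (Suc n)"
              unfolding P_def using assms(2)
              by (intro exI[of _ "insert D' T'"] exI[of _ "[]"]) (auto simp: closed_path_def)
            then show False using not_P by blast
          qed
        qed
      qed (use assms TD \<open>card T < k\<close> in auto)
      then show False by (rule stuck_packing.not_stuck)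
    qed
  qed
  from this[OF order_refl]
  obtain T and D :: "'a list"
    where T: "cycle_packing r T" "length D < r" "card T * r + length D = k * r"
    unfolding P_def by blast
  have "card T = (card T * r + length D) div r" using T(2) by simp
  then have "card T = k" using T(2) by (simp add: T(3))
  then show ?thesis using T(1) by blast
qed

end

section \<open>Degrees and codegrees in a minimal graph\<close>

context
  fixes G :: "'a ugraph"
  assumes simple: "simple_graph G"
begin

abbreviation "adj_in \<equiv> \<lambda>u v. {u, v} \<in> edges G"

lemma edge_obtain:
  assumes "e \<in> edges G"
  obtains u v where "e = {u, v}" "u \<noteq> v"
  using assms simple by (auto simp: simple_graph_def card_2_iff)

lemma fin_graph_ugraph: "fin_graph (verts G) adj_in"
proof
  show "finite (verts G)" using simple by (simp add: simple_graph_def)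
  show "u \<in> verts G" if "{u, v} \<in> edges G" for u v
    using that simple by (auto simp: simple_graph_def)
  show "{v, u} \<in> edges G" if "{u, v} \<in> edges G" for u v
    using that by (simp add: insert_commute)
  show "{u, u} \<notin> edges G" for u
    using simple by (auto simp: simple_graph_def)
qed

interpretation fin_graph "verts G" adj_in
  by (rule fin_graph_ugraph)

lemma finite_edges: "finite (edges G)"
  using simple finite_subset[of "edges G" "Pow (verts G)"]
  by (auto simp: simple_graph_def)

lemma is_cycle_closed_path:
  assumes "closed_path c" "length c \<ge> 3"
  shows "is_cycle G c"
  unfolding is_cycle_def
proof (intro conjI allI impI)
  fix i assume i: "i < length c"
  show "{c ! i, c ! (Suc i mod length c)} \<in> edges G"
  proof (cases "Suc i < length c")
    case True
    then show ?thesis using assms by (auto simp: closed_path_def successively_conv_nth)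
  next
    case False
    then have "length c = Suc i" using i by simp
    then have "i = length c - 1" "Suc i mod length c = 0" by simp_all
    moreover have "c \<noteq> []" using i by auto
    ultimately have "c ! i = last c" "c ! (Suc i mod length c) = hd c"
      by (metis last_conv_nth) (metis \<open>c \<noteq> []\<close> \<open>Suc i mod length c = 0\<close> hd_conv_nth)
    then show ?thesis using assms by (simp add: closed_path_def)
  qed
qed (use assms in \<open>auto simp: closed_path_def\<close>)

lemma card_incident_edges: "card {e \<in> edges G. v \<in> e} = card (nbs v)"
proof -
  have "{e \<in> edges G. v \<in> e} = (\<lambda>u. {v, u}) ` nbs v"
  proof
    show "{e \<in> edges G. v \<in> e} \<subseteq> (\<lambda>u. {v, u}) ` nbs v"
    proof
      fix e assume e: "e \<in> {e \<in> edges G. v \<in> e}"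
      then obtain a b where "e = {a, b}" using edge_obtain by blast
      then obtain u where "e = {v, u}" using e by (cases "v = a") (auto simp: insert_commute)
      then show "e \<in> (\<lambda>u. {v, u}) ` nbs v" using e by simp
    qed
  qed auto
  moreover have "inj_on (\<lambda>u. {v, u}) (nbs v)"
    by (auto simp: inj_on_def doubleton_eq_iff)
  ultimately show ?thesis by (simp add: card_image)
qed

lemma card_edges_le: "2 * card (edges G) \<le> card (verts G) * (card (verts G) - 1)"
proof -
  have "edges G \<subseteq> {e. e \<subseteq> verts G \<and> card e = 2}"
    using simple by (auto simp: simple_graph_def)
  then have "card (edges G) \<le> card (verts G) choose 2"
    using card_mono[OF _ \<open>edges G \<subseteq> _\<close>] finite_V by (simp add: n_subsets)
  then show ?thesis by (simp add: choose_two)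
qed

lemma card_delete_vertex: "card (edges G) = card (edges (delete_vertex G v)) + card (nbs v)"
proof -
  have "card ({e \<in> edges G. v \<notin> e} \<union> {e \<in> edges G. v \<in> e})
      = card {e \<in> edges G. v \<notin> e} + card {e \<in> edges G. v \<in> e}"
    using finite_edges by (intro card_Un_disjoint) auto
  moreover have "{e \<in> edges G. v \<notin> e} \<union> {e \<in> edges G. v \<in> e} = edges G" by auto
  ultimately show ?thesis
    by (simp add: card_incident_edges delete_vertex_def)
qed

text \<open>Outside \<open>?B\<close>, which holds \<open>{u, v}\<close> and the edges from
  \<open>v\<close> to common neighbours, contraction is injective on edges: any other edge at
  \<open>v\<close> becomes an edge at \<open>u\<close> that \<open>G\<close> did not have.\<close>

lemma card_contract_edge:
  assumes uv: "{u, v} \<in> edges G"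
  shows "card (edges G) \<le> card (edges (contract_edge G u v)) + card (nbs u \<inter> nbs v) + 1"
proof -
  let ?f = "\<lambda>e. (id(v := u)) ` e"
  let ?B = "insert {u, v} ((\<lambda>z. {v, z}) ` (nbs u \<inter> nbs v))"
  have unmoved: "?f e = e" if "v \<notin> e" for e
    using that by auto
  have moved: "\<exists>z. e = {v, z} \<and> ?f e = {u, z} \<and> z \<noteq> u \<and> {u, z} \<notin> edges G"
    if e: "e \<in> edges G - ?B" "v \<in> e" for e
  proof -
    obtain a b where "e = {a, b}" "a \<noteq> b" using e(1) edge_obtain by blast
    then obtain z where z: "e = {v, z}" "z \<noteq> v" using e(2) by auto
    have "z \<noteq> u" using e(1) z(1) by (auto simp: insert_commute)
    moreover have "{u, z} \<notin> edges G" using e(1) z(1) by auto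
    ultimately show ?thesis using z by auto
  qed
  have "inj_on ?f (edges G - ?B)"
  proof (rule inj_onI)
    fix e e' assume e: "e \<in> edges G - ?B" "e' \<in> edges G - ?B" and eq: "?f e = ?f e'"
    consider "v \<notin> e" "v \<notin> e'" | "v \<in> e" "v \<notin> e'" | "v \<notin> e" "v \<in> e'" | "v \<in> e" "v \<in> e'"
      by blast
    then show "e = e'"
    proof cases
      case 1
      show ?thesis using eq by (simp only: unmoved[OF 1(1)] unmoved[OF 1(2)])
    next
      case 2
      obtain z where z: "?f e = {u, z}" "{u, z} \<notin> edges G" using moved[OF e(1) 2(1)] by blast
      have "{u, z} = e'" using eq by (simp only: z(1) unmoved[OF 2(2)])
      then show ?thesis using z(2) e(2) by blast
    next
      case 3
      obtain z where z: "?f e' = {u, z}" "{u, z} \<notin> edges G" using moved[OF e(2) 3(2)] by blast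
      have "e = {u, z}" using eq by (simp only: z(1) unmoved[OF 3(1)])
      then show ?thesis using z(2) e(1) by blast
    next
      case 4
      obtain z where z: "e = {v, z}" "?f e = {u, z}" "z \<noteq> u" using moved[OF e(1) 4(1)] by blast
      obtain z' where z': "e' = {v, z'}" "?f e' = {u, z'}" "z' \<noteq> u"
        using moved[OF e(2) 4(2)] by blast
      have "{u, z} = {u, z'}" using eq by (simp only: z(2) z'(2))
      then have "z = z'" using z(3) z'(3) by (simp add: doubleton_eq_iff)
      then show ?thesis using z(1) z'(1) by simp
    qed
  qed
  moreover have "?f ` (edges G - ?B) \<subseteq> edges (contract_edge G u v)"
  proof -
    have "?f e \<noteq> {u}" if e: "e \<in> edges G - ?B" for e
    proof (cases "v \<in> e")
      case True
      then show ?thesis using moved[OF e True] by auto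
    next
      case False
      have "{u} \<notin> edges G" using simple by (auto simp: simple_graph_def)
      then show ?thesis using e unmoved[OF False] by auto
    qed
    then show ?thesis by (auto simp: contract_edge_def)
  qed
  moreover have "finite (edges (contract_edge G u v))"
    using finite_edges by (simp add: contract_edge_def)
  ultimately have "card (edges G - ?B) \<le> card (edges (contract_edge G u v))"
    by (rule card_inj_on_le)
  moreover have "card (edges G) - card ?B \<le> card (edges G - ?B)"
    by (intro diff_card_le_card_Diff) auto
  moreover have "card ?B \<le> Suc (card (nbs u \<inter> nbs v))"
    by (rule order_trans[OF card_insert_le_m1]) (auto intro: card_image_le)
  ultimately show ?thesis by linarith
qed

end

text \<open>Deleting a vertex of degree \<open>m\<close>, or contracting an edge in \<open>m - 1\<close> triangles, loses
  \<open>m\<close> edges, so the average degree drops only if \<open>m\<close> exceeds half of it.\<close>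

lemma loss_bound:
  fixes n e e' m k r :: nat
  assumes n: "n \<ge> 2" and loss: "e \<le> e' + m"
    and drop: "2 * real e' / real (n - 1) < 2 * real e / real n"
    and dense: "4 / 3 * real k * real r \<le> 2 * real e / real n"
  shows "2 * k * r + 1 \<le> 3 * m"
proof -
  have "real e' * real n < real e * (real n - 1)"
    using drop n by (simp add: divide_simps of_nat_diff split: if_splits)
  moreover have "(real e - real m) * real n \<le> real e' * real n"
    using loss by (intro mult_right_mono) linarith+
  ultimately have "real e < real m * real n" by (simp add: algebra_simps)
  moreover have "4 / 3 * real k * real r * real n \<le> 2 * real e"
    using dense n by (simp add: divide_simps split: if_splits)
  ultimately have "(2 * real k * real r) * real n < (3 * real m) * real n"
    by (simp add: algebra_simps)
  then have "2 * real k * real r < 3 * real m" using n by simp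
  then have "real (2 * k * r) < real (3 * m)" by simp
  then show ?thesis by linarith
qed

theorem theorem3:
  fixes G :: "'a ugraph" and k r :: nat
  assumes "k \<ge> 6" and "r \<ge> 3"
    and "simple_graph G" and "minimal_graph G"
    and "avg_degree G \<ge> 4 / 3 * real k * real r"
  shows "\<exists>C :: 'a list set. card C = k \<and>
           (\<forall>c\<in>C. is_cycle G c \<and> length c \<ge> r) \<and>
           pairwise (\<lambda>c d. disjnt (set c) (set d)) C"
proof -
  interpret fin_graph "verts G" "\<lambda>u v. {u, v} \<in> edges G"
    by (rule fin_graph_ugraph) (rule assms(3))
  let ?n = "card (verts G)" and ?e = "card (edges G)"
  have dense: "4 / 3 * real k * real r \<le> 2 * real ?e / real ?n"
    using assms(5) by (simp add: avg_degree_def)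
  have kr: "real k * real r \<ge> 18"
    using mult_mono[of 6 "real k" 3 "real r"] assms(1,2) by simp
  \<comment> \<open>Division by zero gives the null graph average degree 0, so the density bound
    excludes it.\<close>
  have n0: "?n > 0" using dense kr by (cases "?n = 0") auto
  \<comment> \<open>The average degree is at most \<open>?n - 1\<close>, which forces at least
    \<open>k * r\<close> vertices.\<close>
  have "real (2 * ?e) \<le> real (?n * (?n - 1))"
    using card_edges_le[OF assms(3)] by (rule of_nat_mono)
  moreover have "real (?n - 1) = real ?n - 1" using n0 by linarith
  ultimately have "2 * real ?e \<le> (real ?n - 1) * real ?n"
    unfolding of_nat_mult by (simp only: mult.commute of_nat_numeral)
  then have "2 * real ?e / real ?n \<le> real ?n - 1"
    using n0 by (subst pos_divide_le_eq) simp_all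
  then have "real k * real r \<le> real ?n" using dense kr by linarith
  then have "real (k * r) \<le> real ?n" unfolding of_nat_mult .
  then have n: "k * r \<le> ?n" by (rule of_nat_le_iff[THEN iffD1])
  have n2: "?n \<ge> 2" using kr \<open>real k * real r \<le> real ?n\<close> by linarith
  have degree: "2 * k * r + 1 \<le> 3 * card (nbs v)" if v: "v \<in> verts G" for v
  proof (rule loss_bound[OF n2 _ _ dense])
    show "?e \<le> card (edges (delete_vertex G v)) + card (nbs v)"
      using card_delete_vertex[OF assms(3), of v] by simp
    have card: "card (verts (delete_vertex G v)) = ?n - 1"
      using v by (simp add: delete_vertex_def)
    have "avg_degree (delete_vertex G v) < avg_degree G"
      using assms(4) v unfolding minimal_graph_def by blast
    then show "2 * real (card (edges (delete_vertex G v))) / real (?n - 1) < 2 * real ?e / real ?n"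
      unfolding avg_degree_def card .
  qed
  have codegree: "2 * k * r \<le> 3 * card (nbs u \<inter> nbs v) + 2" if uv: "{u, v} \<in> edges G" for u v
  proof -
    have "2 * k * r + 1 \<le> 3 * (card (nbs u \<inter> nbs v) + 1)"
    proof (rule loss_bound[OF n2 _ _ dense])
      show "?e \<le> card (edges (contract_edge G u v)) + (card (nbs u \<inter> nbs v) + 1)"
        using card_contract_edge[OF assms(3) uv] by simp
      have "v \<in> verts G" using uv adj_in_V[of v u] by (simp add: insert_commute)
      then have card: "card (verts (contract_edge G u v)) = ?n - 1"
        by (simp add: contract_edge_def)
      have "avg_degree (contract_edge G u v) < avg_degree G"
        using assms(4) uv unfolding minimal_graph_def by blast
      then show "2 * real (card (edges (contract_edge G u v))) / real (?n - 1)
          < 2 * real ?e / real ?n"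
        unfolding avg_degree_def card .
    qed
    then show ?thesis by simp
  qed
  have "k \<ge> 3" using assms(1) by simp
  from ex_cycle_packing[OF this assms(2) degree codegree n]
  obtain T where T: "cycle_packing r T" "card T = k" by blast
  have "is_cycle G c \<and> length c \<ge> r" if "c \<in> T" for c
    using T(1) that is_cycle_closed_path[OF assms(3), of c] assms(2) by (simp add: cycle_packing_def)
  moreover have "pairwise (\<lambda>c d. disjnt (set c) (set d)) T"
    using T(1) by (simp add: cycle_packing_def)
  ultimately show ?thesis using T(2) by blast
qed

end
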